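(* For every positive integer $k$ there is a deterministic algorithm in the ordinal query model that, on every finite metric space $(X,d)$ and every consistent profile, makes at most $2k$ distance queries and outputs a set $C\subseteq X$ with $|C|\le k$ such that $\max_{x\in X}d(x,C)\le 4\cdot\mathrm{OPT}^{\mathrm{center}}_k(X,d)$.
   Context: Ordinal query model: $(X,d)$ is a finite metric space with $|X|=n$. Every point $x\in X$ reports a ranking $\pi_x$ of all points of $X$ such that $y$ is ranked above $y'$ only if $d(x,y)\le d(x,y')$ (ties broken arbitrarily); the collection $P=\{\pi_x\}_{x\in X}$ is a profile consistent with $d$. An algorithm receives $X$, $k$ and $P$ for free. Its only other access to $d$ is by querying the exact value $d(x,y)$ for pairs of its choice; each such value costs one query. For $C\subseteq X$ write $d(x,C)=\min_{c\in C}d(x,c)$. The $k$-center cost of $C$ is $\max_{x\in X}d(x,C)$, and $\mathrm{OPT}^{\mathrm{center}}_k(X,d)=\min_{C\subseteq X,|C|=k}\max_{x\in X}d(x,C)$. *)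

theory Defs
  imports Main "HOL.Real"
begin

definition is_metric_on :: "'a set \<Rightarrow> ('a \<Rightarrow> 'a \<Rightarrow> real) \<Rightarrow> bool" where
  "is_metric_on X d \<longleftrightarrow>
     (\<forall>x\<in>X. d x x = 0) \<and>
     (\<forall>x\<in>X. \<forall>y\<in>X. x \<noteq> y \<longrightarrow> d x y > 0) \<and>
     (\<forall>x\<in>X. \<forall>y\<in>X. d x y = d y x) \<and>
     (\<forall>x\<in>X. \<forall>y\<in>X. \<forall>z\<in>X. d x z \<le> d x y + d y z)"

definition consistent_profile ::
  "'a set \<Rightarrow> ('a \<Rightarrow> 'a \<Rightarrow> real) \<Rightarrow> ('a \<Rightarrow> 'a list) \<Rightarrow> bool" where
  "consistent_profile X d P \<longleftrightarrow>
     (\<forall>x\<in>X. distinct (P x) \<and> set (P x) = X \<and>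
        (\<forall>i j. i < j \<and> j < length (P x) \<longrightarrow> d x (P x ! i) \<le> d x (P x ! j)))"

definition dist_to_set :: "('a \<Rightarrow> 'a \<Rightarrow> real) \<Rightarrow> 'a \<Rightarrow> 'a set \<Rightarrow> real" where
  "dist_to_set d x C = Min (d x ` C)"

definition center_cost :: "'a set \<Rightarrow> ('a \<Rightarrow> 'a \<Rightarrow> real) \<Rightarrow> 'a set \<Rightarrow> real" where
  "center_cost X d C = Max ((\<lambda>x. dist_to_set d x C) ` X)"

text \<open>OPT: minimum over nonempty centre sets of size at most k (equals the minimum over
  sets of size exactly k whenever k \<le> |X|).\<close>
definition opt_center :: "'a set \<Rightarrow> ('a \<Rightarrow> 'a \<Rightarrow> real) \<Rightarrow> nat \<Rightarrow> real" where
  "opt_center X d k = Min {center_cost X d C | C. C \<subseteq> X \<and> C \<noteq> {} \<and> card C \<le> k}"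

datatype 'a qtree = Output "'a set" | Query 'a 'a "real \<Rightarrow> 'a qtree"

primrec run_tree :: "'a qtree \<Rightarrow> ('a \<Rightarrow> 'a \<Rightarrow> real) \<Rightarrow> 'a set \<times> nat" where
  "run_tree (Output C) d = (C, 0)"
| "run_tree (Query x y f) d = (fst (run_tree (f (d x y)) d), Suc (snd (run_tree (f (d x y)) d)))"

end

theory Submission
  imports Defs
begin

text \<open>
  The algorithm is a lazy farthest-first traversal. A point belongs to the cluster of the centre
  that it ranks first. Some centres \<open>c\<close> carry a witness \<open>t c\<close>: a point farthest from \<open>c\<close> in its
  cluster, at distance \<open>v c\<close> obtained by a query.

  Let \<open>f\<close> be a farthest point of the cluster of a centre \<open>c\<close> without witness. If some witness
  \<open>t e\<close> ranks \<open>f\<close> above its own centre \<open>e\<close>, then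
  \<open>d f c \<le> d f e \<le> d f (t e) + d (t e) e \<le> 2 * v e\<close>, so no query is needed for \<open>c\<close>. Otherwise query
  \<open>d f c\<close> and make \<open>f\<close> the witness of \<open>c\<close>. Once no such query is left, the witness \<open>x = t s\<close> with the
  largest value is farthest from the centres up to a factor 2; it becomes a centre and \<open>s\<close> loses
  its witness. The other witnesses stay valid: of two witnesses at most one ranks the other above
  its own centre, so either \<open>t e\<close> is at least as close to \<open>e\<close> as to \<open>x\<close>, or
  \<open>d x (t e) \<ge> d x s = v s \<ge> v e\<close>.

  A witness is lost only by becoming a centre, which bounds the number of queries by \<open>2 * k - 1\<close>. The
  \<open>k\<close> centres together with a farthest point are pairwise at least half the cost apart, and two of
  these \<open>k + 1\<close> points share a centre of an optimal solution.
\<close>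

section \<open>Positions in rankings and the distance comparisons they imply\<close>

definition rank :: "'a list \<Rightarrow> 'a \<Rightarrow> nat" where
  "rank l a = length (takeWhile (\<lambda>b. b \<noteq> a) l)"

lemma rank_less_length: "a \<in> set l \<Longrightarrow> rank l a < length l"
  unfolding rank_def by (induction l) auto

lemma nth_rank: "a \<in> set l \<Longrightarrow> l ! rank l a = a"
  using rank_less_length[of a l] nth_length_takeWhile[of "\<lambda>b. b \<noteq> a" l]
  unfolding rank_def by simp

lemma consistent_profile_rank_le:
  assumes "consistent_profile X d P" "x \<in> X" "a \<in> X" "b \<in> X" "rank (P x) a \<le> rank (P x) b"
  shows "d x a \<le> d x b"
proof -
  have P: "set (P x) = X" "\<And>i j. i < j \<Longrightarrow> j < length (P x) \<Longrightarrow> d x (P x ! i) \<le> d x (P x ! j)"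
    using assms unfolding consistent_profile_def by blast+
  have ab: "P x ! rank (P x) a = a" "P x ! rank (P x) b = b" "rank (P x) b < length (P x)"
    using P(1) assms by (auto simp: nth_rank rank_less_length)
  show ?thesis
  proof (cases "rank (P x) a = rank (P x) b")
    case True
    then have "a = b" using ab by metis
    then show ?thesis by simp
  next
    case False
    then have "rank (P x) a < rank (P x) b" using assms(5) by simp
    from P(2)[OF this ab(3)] show ?thesis unfolding ab .
  qed
qed

lemma ex_min_on_finite:
  fixes g :: "'a \<Rightarrow> 'b::linorder"
  assumes "finite A" "A \<noteq> {}"
  shows "\<exists>a\<in>A. \<forall>b\<in>A. g a \<le> g b"
proof -
  obtain a where "a \<in> A" "g a = Min (g ` A)" using Min_in[of "g ` A"] assms by fastforce
  then show ?thesis using assms by (intro bexI[of _ a]) auto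
qed

lemma ex_max_on_finite:
  fixes g :: "'a \<Rightarrow> 'b::linorder"
  assumes "finite A" "A \<noteq> {}"
  shows "\<exists>a\<in>A. \<forall>b\<in>A. g b \<le> g a"
proof -
  obtain a where "a \<in> A" "g a = Max (g ` A)" using Max_in[of "g ` A"] assms by fastforce
  then show ?thesis using assms by (intro bexI[of _ a]) auto
qed

section \<open>Costs of centre sets and lower bounds on the optimum\<close>

lemma dist_to_set_le: "finite C \<Longrightarrow> c \<in> C \<Longrightarrow> dist_to_set d x C \<le> d x c"
  unfolding dist_to_set_def by (intro Min_le) auto

lemma dist_to_set_attained:
  assumes "finite C" "C \<noteq> {}"
  shows "\<exists>c\<in>C. dist_to_set d x C = d x c"
proof -
  have "Min (d x ` C) \<in> d x ` C" using assms by (intro Min_in) auto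
  then show ?thesis unfolding dist_to_set_def by blast
qed

lemma dist_to_set_le_center_cost: "finite X \<Longrightarrow> x \<in> X \<Longrightarrow> dist_to_set d x C \<le> center_cost X d C"
  unfolding center_cost_def by (intro Max_ge) auto

lemma center_cost_attained:
  assumes "finite X" "X \<noteq> {}"
  shows "\<exists>x\<in>X. center_cost X d C = dist_to_set d x C"
proof -
  have "Max ((\<lambda>x. dist_to_set d x C) ` X) \<in> (\<lambda>x. dist_to_set d x C) ` X"
    using assms by (intro Max_in) auto
  then show ?thesis unfolding center_cost_def by blast
qed

lemma center_cost_leI:
  assumes "finite X" "X \<noteq> {}" "finite C" "\<And>x. x \<in> X \<Longrightarrow> \<exists>c\<in>C. d x c \<le> r"
  shows "center_cost X d C \<le> r"
proof -
  obtain x where x: "x \<in> X" "center_cost X d C = dist_to_set d x C"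
    using center_cost_attained assms(1,2) by metis
  then obtain c where "c \<in> C" "d x c \<le> r" using assms(4) by blast
  then show ?thesis using x dist_to_set_le[of C c d x] assms(3) by simp
qed

lemma center_cost_antimono:
  assumes "finite X" "X \<noteq> {}" "finite C'" "C \<subseteq> C'" "C \<noteq> {}"
  shows "center_cost X d C' \<le> center_cost X d C"
proof (rule center_cost_leI)
  fix x assume "x \<in> X"
  then show "\<exists>c\<in>C'. d x c \<le> center_cost X d C"
    using dist_to_set_attained[of C d x] dist_to_set_le_center_cost[of X x d C] assms
    by (metis finite_subset subsetD)
qed (use assms in auto)

lemma is_metric_on_nonneg:
  assumes "is_metric_on X d" "x \<in> X" "y \<in> X"
  shows "0 \<le> d x y"
  using assms unfolding is_metric_on_def by (metis less_eq_real_def)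

lemma center_cost_nonneg:
  assumes "finite X" "X \<noteq> {}" "is_metric_on X d" "C \<subseteq> X" "C \<noteq> {}"
  shows "0 \<le> center_cost X d C"
proof -
  obtain x where x: "x \<in> X" using assms by auto
  obtain c where "c \<in> C" "dist_to_set d x C = d x c"
    using dist_to_set_attained assms by (metis finite_subset)
  then show ?thesis
    using x is_metric_on_nonneg[of X d x c] dist_to_set_le_center_cost[of X x d C] assms by auto
qed

lemma le_opt_centerI:
  assumes "finite X" "X \<noteq> {}" "k > 0"
    and "\<And>B. B \<subseteq> X \<Longrightarrow> B \<noteq> {} \<Longrightarrow> card B \<le> k \<Longrightarrow> r \<le> center_cost X d B"
  shows "r \<le> opt_center X d k"
proof -
  let ?F = "{center_cost X d C | C. C \<subseteq> X \<and> C \<noteq> {} \<and> card C \<le> k}"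
  have "?F \<subseteq> center_cost X d ` Pow X" by auto
  then have fin: "finite ?F" using assms(1) by (meson finite_Pow_iff finite_imageI finite_subset)
  obtain x where "x \<in> X" using assms(2) by auto
  then have "center_cost X d {x} \<in> ?F" using assms(3) by (intro CollectI exI[of _ "{x}"]) auto
  then have "?F \<noteq> {}" by blast
  with fin have "Min ?F \<in> ?F" by (rule Min_in)
  then obtain B where "B \<subseteq> X" "B \<noteq> {}" "card B \<le> k" "Min ?F = center_cost X d B" by blast
  then show ?thesis using assms(4)[of B] unfolding opt_center_def by simp
qed

lemma center_cost_le_4_opt_of_separated:
  assumes X: "finite X" "X \<noteq> {}" and d: "is_metric_on X d" and C: "C \<subseteq> X" "C \<noteq> {}" "card C = k"
    and sep: "\<forall>c\<in>C. \<forall>c'\<in>C. c \<noteq> c' \<longrightarrow> center_cost X d C \<le> 2 * d c c'"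
  shows "center_cost X d C \<le> 4 * opt_center X d k"
proof -
  let ?R = "center_cost X d C"
  have finC: "finite C" using C X finite_subset by blast
  have tri: "d x z \<le> d x y + d y z" "d x y = d y x" "d x x = 0"
    if "x \<in> X" "y \<in> X" "z \<in> X" for x y z
    using d that unfolding is_metric_on_def by blast+
  have "?R / 4 \<le> center_cost X d B" if B: "B \<subseteq> X" "B \<noteq> {}" "card B \<le> k" for B
  \<comment> \<open>Positivity of \<open>?R\<close> is what keeps the farthest point
    \<open>f\<close> outside \<open>C\<close>, so that \<open>insert f C\<close> really has
    \<open>k + 1\<close> points.\<close>
  proof (cases "?R \<le> 0")
    case True
    then show ?thesis using center_cost_nonneg[of X d B] X d B by simp
  next
    case False
    have finB: "finite B" using B X finite_subset by blast
    obtain f where f: "f \<in> X" "?R = dist_to_set d f C" using center_cost_attained X by metis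
    have fC: "?R \<le> d f c" if "c \<in> C" for c using f dist_to_set_le finC that by metis
    have fnC: "f \<notin> C" using fC[of f] False tri(3) f(1) by auto
    have sepf: "?R \<le> 2 * d p q" if "p \<in> insert f C" "q \<in> insert f C" "p \<noteq> q" for p q
    proof -
      consider "p \<in> C" "q \<in> C" | "p = f" "q \<in> C" | "p \<in> C" "q = f" using \<open>p \<noteq> q\<close> \<open>p \<in> insert f C\<close> \<open>q \<in> insert f C\<close> by blast
      then show ?thesis
      proof cases
        case 1
        then show ?thesis using sep that by blast
      next
        case 2
        then show ?thesis using fC[of q] False by simp
      next
        case 3
        then have "d p q = d f p" using tri(2)[of p f p] f(1) C by blast
        then show ?thesis using fC[of p] 3 False by simp
      qed
    qed
    have "\<forall>p\<in>X. \<exists>b\<in>B. d p b \<le> center_cost X d B"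
      using dist_to_set_attained[OF finB B(2)] dist_to_set_le_center_cost[OF X(1)] by metis
    then obtain g where g: "\<And>p. p \<in> X \<Longrightarrow> g p \<in> B" "\<And>p. p \<in> X \<Longrightarrow> d p (g p) \<le> center_cost X d B"
      by metis
    have "g ` insert f C \<subseteq> B" using g(1) f(1) C by auto
    then have "card (g ` insert f C) \<le> k" using card_mono finB B(3) by (meson le_trans)
    also have "k < card (insert f C)" using fnC finC C(3) by simp
    finally have "\<not> inj_on g (insert f C)" by (rule pigeonhole)
    then obtain p q where pq: "p \<in> insert f C" "q \<in> insert f C" "p \<noteq> q" "g p = g q"
      unfolding inj_on_def by blast
    then have pqX: "p \<in> X" "q \<in> X" "g p \<in> X" using g(1) f(1) C B by auto
    \<comment> \<open>The detour through the shared centre \<open>g p\<close> has two legs of at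
      most the cost of \<open>B\<close>, and \<open>d p q\<close> is at least \<open>?R / 2\<close>;
      this makes the factor 4.\<close>
    have "d p q \<le> d p (g p) + d (g p) q" "d (g p) q = d q (g q)" using tri pqX pq(4) by metis+
    then show ?thesis using sepf[OF pq(1-3)] g(2)[OF pqX(1)] g(2)[OF pqX(2)] by linarith
  qed
  moreover have "k > 0" using C finC by auto
  ultimately have "?R / 4 \<le> opt_center X d k" using le_opt_centerI X by blast
  then show ?thesis by simp
qed

section \<open>Clusters, witnesses and the invariant of the traversal\<close>

definition in_cluster :: "('a \<Rightarrow> 'a list) \<Rightarrow> 'a set \<Rightarrow> 'a \<Rightarrow> 'a \<Rightarrow> bool" where
  "in_cluster P C c y \<longleftrightarrow> (\<forall>c'\<in>C. rank (P y) c \<le> rank (P y) c')"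

text \<open>Kept apart from \<open>search_state\<close> because it does not mention
  \<open>d\<close>: it is known while the tree is built, before any metric is fixed.\<close>

definition witnesses_unrelated :: "('a \<Rightarrow> 'a list) \<Rightarrow> 'a set \<Rightarrow> ('a \<Rightarrow> 'a) \<Rightarrow> bool" where
  "witnesses_unrelated P D t \<longleftrightarrow>
     (\<forall>c\<in>D. \<forall>e\<in>D. c \<noteq> e \<longrightarrow>
        \<not> (rank (P (t c)) (t e) \<le> rank (P (t c)) c \<and> rank (P (t e)) (t c) \<le> rank (P (t e)) e))"

text \<open>\<open>D\<close> is the set of centres with a witness. The clause on clusters is only an upper bound on
  the radius, because later centres may take points away from the cluster of \<open>c\<close>.\<close>
definition search_state ::
  "'a set \<Rightarrow> ('a \<Rightarrow> 'a list) \<Rightarrow> 'a set \<Rightarrow> 'a set \<Rightarrow> ('a \<Rightarrow> 'a) \<Rightarrow> ('a \<Rightarrow> real) \<Rightarrow>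
     ('a \<Rightarrow> 'a \<Rightarrow> real) \<Rightarrow> bool" where
  "search_state X P C D t v d \<longleftrightarrow>
     is_metric_on X d \<and> consistent_profile X d P \<and>
     (\<forall>c\<in>D. t c \<in> X \<and> v c = d (t c) c \<and> (\<forall>c'\<in>C. d (t c) c \<le> d (t c) c')) \<and>
     (\<forall>c\<in>D. \<forall>y\<in>X. in_cluster P C c y \<longrightarrow> d y c \<le> v c) \<and>
     (\<forall>c\<in>C. \<forall>c'\<in>C. c \<noteq> c' \<longrightarrow> center_cost X d C \<le> 2 * d c c')"

text \<open>Only rankings and the current state occur here, so the next query can be chosen for
  free. The last clause leaves out the centres whose radius is already bounded by twice the value of
  some witness.\<close>

definition needs_query ::
  "'a set \<Rightarrow> ('a \<Rightarrow> 'a list) \<Rightarrow> 'a set \<Rightarrow> 'a set \<Rightarrow> ('a \<Rightarrow> 'a) \<Rightarrow> 'a \<Rightarrow> 'a \<Rightarrow> bool" where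
  "needs_query X P C D t c f \<longleftrightarrow>
     c \<in> C - D \<and> f \<in> X \<and> in_cluster P C c f \<and>
     (\<forall>y\<in>X. in_cluster P C c y \<longrightarrow> rank (P c) y \<le> rank (P c) f) \<and>
     (\<forall>e\<in>D. \<not> rank (P (t e)) f \<le> rank (P (t e)) e)"

lemma search_state_query:
  assumes st: "search_state X P C D t v d" and C: "C \<subseteq> X" and q: "needs_query X P C D t c f"
  shows "search_state X P C (insert c D) (t(c := f)) (v(c := d f c)) d"
proof -
  have m: "is_metric_on X d" and p: "consistent_profile X d P"
    using st unfolding search_state_def by auto
  have c: "c \<in> C" "c \<notin> D" "c \<in> X" "f \<in> X" using q C unfolding needs_query_def by auto
  have sym: "d x y = d y x" if "x \<in> X" "y \<in> X" for x y
    using m that unfolding is_metric_on_def by blast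
  have "d f c \<le> d f c'" if "c' \<in> C" for c'
    using consistent_profile_rank_le[OF p, of f c c'] q c C that
    unfolding needs_query_def in_cluster_def by blast
  moreover have "d y c \<le> d f c" if "y \<in> X" "in_cluster P C c y" for y
    using consistent_profile_rank_le[OF p, of c y f] q c that sym unfolding needs_query_def by metis
  ultimately show ?thesis using st c unfolding search_state_def by auto
qed

text \<open>For a pair made of \<open>f\<close> and an old witness \<open>t e\<close>, the last
  clause of \<open>needs_query\<close> refutes the comparison made by \<open>t e\<close>; the other
  pairs are unchanged.\<close>

lemma witnesses_unrelated_query:
  assumes "witnesses_unrelated P D t" "needs_query X P C D t c f"
  shows "witnesses_unrelated P (insert c D) (t(c := f))"
  using assms unfolding witnesses_unrelated_def needs_query_def by auto

text \<open>A centre whose cluster holds a point realising the cost either has a witness itself or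
  was spared a query because of one. In particular \<open>D\<close> is nonempty once no query is
  left.\<close>

lemma center_cost_le_witness:
  assumes st: "search_state X P C D t v d" and X: "finite X" "X \<noteq> {}"
    and C: "C \<subseteq> X" "C \<noteq> {}" and D: "D \<subseteq> C"
    and no: "\<nexists>c f. needs_query X P C D t c f"
  shows "\<exists>e\<in>D. center_cost X d C \<le> 2 * v e"
proof -
  have m: "is_metric_on X d" and p: "consistent_profile X d P"
    and wit: "\<And>c. c \<in> D \<Longrightarrow> t c \<in> X" "\<And>c. c \<in> D \<Longrightarrow> v c = d (t c) c"
    and far: "\<And>c y. c \<in> D \<Longrightarrow> y \<in> X \<Longrightarrow> in_cluster P C c y \<Longrightarrow> d y c \<le> v c"
    using st unfolding search_state_def by auto
  have finC: "finite C" using C X finite_subset by blast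
  have tri: "d x z \<le> d x y + d y z" "d x y = d y x" if "x \<in> X" "y \<in> X" "z \<in> X" for x y z
    using m that unfolding is_metric_on_def by blast+
  obtain y where y: "y \<in> X" "center_cost X d C = dist_to_set d y C"
    using center_cost_attained X by metis
  obtain c where c: "c \<in> C" "in_cluster P C c y"
    using ex_min_on_finite[OF finC C(2), of "rank (P y)"] unfolding in_cluster_def by blast
  have cX: "c \<in> X" using c C by blast
  have yc: "center_cost X d C \<le> d y c" using y dist_to_set_le finC c by metis
  show ?thesis
  proof (cases "c \<in> D")
    case True
    have "0 \<le> d y c" using is_metric_on_nonneg m y cX by metis
    then have "center_cost X d C \<le> 2 * v c" using far[OF True y(1) c(2)] yc by simp
    then show ?thesis using True by blast
  next
    case False
    let ?K = "{z \<in> X. in_cluster P C c z}"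
    have "finite ?K" "?K \<noteq> {}" using X y c by auto
    from ex_max_on_finite[OF this, of "rank (P c)"]
    obtain f where f: "f \<in> ?K" "\<forall>z\<in>?K. rank (P c) z \<le> rank (P c) f" by blast
    \<comment> \<open>The farthest point \<open>f\<close> meets every clause of
      \<open>needs_query\<close> but the last, so the last one fails, and \<open>e\<close> is the
      centre at which it fails.\<close>
    then obtain e where e: "e \<in> D" "rank (P (t e)) f \<le> rank (P (t e)) e"
      using no False c unfolding needs_query_def by blast
    have in_X: "f \<in> X" "e \<in> X" "t e \<in> X" using f e D C wit by auto
    have "d c y \<le> d c f" using consistent_profile_rank_le[OF p cX y(1) in_X(1)] f y c by blast
    moreover have "d f c \<le> d f e"
      using consistent_profile_rank_le[OF p in_X(1) cX in_X(2)] f e D unfolding in_cluster_def by blast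
    moreover have "d (t e) f \<le> d (t e) e"
      using consistent_profile_rank_le[OF p in_X(3,1,2)] e by blast
    moreover have "d f e \<le> d f (t e) + d (t e) e" "d f (t e) = d (t e) f" "d y c = d c y" "d f c = d c f"
      using tri in_X y cX by blast+
    ultimately have "center_cost X d C \<le> 2 * v e" using yc wit(2)[OF e(1)] by linarith
    then show ?thesis using e by blast
  qed
qed

lemma search_state_open:
  assumes st: "search_state X P C D t v d" and X: "finite X" "X \<noteq> {}"
    and C: "C \<subseteq> X" "C \<noteq> {}" and D: "D \<subseteq> C" and un: "witnesses_unrelated P D t"
    and no: "\<nexists>c f. needs_query X P C D t c f"
    and s: "s \<in> D" "\<forall>e\<in>D. v e \<le> v s"
  shows "search_state X P (insert (t s) C) (D - {s}) t v d"
proof -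
  have m: "is_metric_on X d" and p: "consistent_profile X d P"
    and wit: "\<And>c. c \<in> D \<Longrightarrow> t c \<in> X" "\<And>c. c \<in> D \<Longrightarrow> v c = d (t c) c"
      "\<And>c c'. c \<in> D \<Longrightarrow> c' \<in> C \<Longrightarrow> d (t c) c \<le> d (t c) c'"
    and far: "\<And>c y. c \<in> D \<Longrightarrow> y \<in> X \<Longrightarrow> in_cluster P C c y \<Longrightarrow> d y c \<le> v c"
    and sep: "\<And>c c'. c \<in> C \<Longrightarrow> c' \<in> C \<Longrightarrow> c \<noteq> c' \<Longrightarrow> center_cost X d C \<le> 2 * d c c'"
    using st unfolding search_state_def by auto
  have finC: "finite C" using C X finite_subset by blast
  have sym: "d x y = d y x" if "x \<in> X" "y \<in> X" for x y
    using m that unfolding is_metric_on_def by blast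
  let ?x = "t s"
  have sX: "s \<in> X" "?x \<in> X" using s D C wit by auto
  have valid: "d (t e) e \<le> d (t e) ?x" if e: "e \<in> D" "e \<noteq> s" for e
  proof -
    have eX: "e \<in> X" "t e \<in> X" using e D C wit by auto
    consider "rank (P (t e)) e \<le> rank (P (t e)) ?x" | "rank (P ?x) s \<le> rank (P ?x) (t e)"
      using un e s unfolding witnesses_unrelated_def by (meson linear)
    then show ?thesis
    proof cases
      case 1
      then show ?thesis using consistent_profile_rank_le[OF p eX(2,1) sX(2)] by blast
    next
      case 2
      then have "d ?x s \<le> d ?x (t e)" using consistent_profile_rank_le[OF p sX(2,1) eX(2)] by blast
      moreover have "v e \<le> v s" using s e by blast
      ultimately show ?thesis
        using wit(2)[OF s(1)] wit(2)[OF e(1)] sym[OF sX(2) eX(2)] by linarith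
    qed
  qed
  obtain e where "e \<in> D" "center_cost X d C \<le> 2 * v e"
    using center_cost_le_witness[OF st X C D no] by blast
  then have R: "center_cost X d C \<le> 2 * v s" using s by force
  \<comment> \<open>Separation is measured against the current cost, which can only drop, so old
    pairs of centres stay separated.\<close>
  have mono: "center_cost X d (insert ?x C) \<le> center_cost X d C"
    using center_cost_antimono[of X "insert ?x C" C d] X C finC by blast
  \<comment> \<open>No centre is nearer to \<open>?x\<close> than \<open>s\<close>, hence all are at
    distance at least \<open>v s\<close>, which is at least half the cost.\<close>
  have new: "center_cost X d C \<le> 2 * d ?x c" "d c ?x = d ?x c" if "c \<in> C" for c
    using R wit(2)[OF s(1)] wit(3)[OF s(1) that] sym sX C that by auto
  have "center_cost X d (insert ?x C) \<le> 2 * d c c'"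
    if "c \<in> insert ?x C" "c' \<in> insert ?x C" "c \<noteq> c'" for c c'
  proof -
    have "center_cost X d C \<le> 2 * d c c'" using that sep new by (metis insertE)
    then show ?thesis using mono by simp
  qed
  moreover have "in_cluster P C c y" if "in_cluster P (insert ?x C) c y" for c y
    using that unfolding in_cluster_def by blast
  ultimately show ?thesis using m p wit valid far unfolding search_state_def by auto
qed

section \<open>Construction of the query tree and its budget\<close>

definition good_run :: "'a set \<Rightarrow> nat \<Rightarrow> nat \<Rightarrow> ('a \<Rightarrow> 'a \<Rightarrow> real) \<Rightarrow> 'a qtree \<Rightarrow> bool" where
  "good_run X k b d q \<longleftrightarrow>
     snd (run_tree q d) \<le> b \<and> fst (run_tree q d) \<subseteq> X \<and> fst (run_tree q d) \<noteq> {} \<and>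
     card (fst (run_tree q d)) \<le> k \<and> center_cost X d (fst (run_tree q d)) \<le> 4 * opt_center X d k"

lemma good_run_Query: "good_run X k b d (g (d x y)) \<Longrightarrow> good_run X k (Suc b) d (Query x y g)"
  unfolding good_run_def by simp

lemma good_run_mono: "good_run X k b d q \<Longrightarrow> b \<le> b' \<Longrightarrow> good_run X k b' d q"
  unfolding good_run_def by simp

text \<open>The tree is found by induction on the state, so the algorithm needs no explicit recursive
  definition; \<open>m\<close> counts the centres still to be opened.\<close>
lemma ex_search_tree:
  assumes "finite X" "X \<noteq> {}" "C \<subseteq> X" "C \<noteq> {}" "D \<subseteq> C" "card C + m = k"
    "witnesses_unrelated P D t"
  shows "\<exists>q. \<forall>d. search_state X P C D t v d \<longrightarrow> good_run X k (2 * m + (card C - card D)) d q"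
  using assms
\<comment> \<open>A query lowers \<open>card C - card D\<close> by 1. An opening raises it by 2, one
  for the new centre and one for \<open>s\<close>, and lowers \<open>m\<close> by 1. Weight 2 on
  \<open>m\<close> thus keeps the budget constant under openings, while weight 3 makes the measure
  decrease.\<close>
proof (induction "3 * m + (card C - card D)" arbitrary: m C D t v rule: less_induct)
  case less
  note X = less.prems(1,2) and C = less.prems(3,4) and D = less.prems(5)
    and card = less.prems(6) and un = less.prems(7)
  have finC: "finite C" using C X finite_subset by blast
  have finD: "finite D" using finC D finite_subset by blast
  have DC: "card D \<le> card C" using card_mono finC D by blast
  have out: "good_run X k b d (Output C)"
    if "center_cost X d C \<le> 4 * opt_center X d k" for d b
    using that C card unfolding good_run_def by simp
  consider (final) "m = 0" | (ask) c f where "needs_query X P C D t c f"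
    | (extend) "m > 0" "\<nexists>c f. needs_query X P C D t c f" by blast
  then show ?case
  proof cases
    case final
    then have "good_run X k (2 * m + (card C - card D)) d (Output C)"
      if "search_state X P C D t v d" for d
      using that out center_cost_le_4_opt_of_separated[of X d C k] X C card
      unfolding search_state_def by auto
    then show ?thesis by blast
  next
    case ask
    then have c: "c \<in> C" "c \<notin> D" unfolding needs_query_def by auto
    have "insert c D \<subseteq> C" using c D by blast
    moreover from this have "card (insert c D) \<le> card C" using card_mono finC by blast
    moreover have card_D: "card (insert c D) = Suc (card D)" using c finD by simp
    \<comment> \<open>One subtree for each possible answer \<open>r\<close>, recorded as the value
      of \<open>c\<close>; only metrics with \<open>d f c = r\<close> can satisfy the resulting
      state.\<close>
    ultimately have "\<exists>q. \<forall>d. search_state X P C (insert c D) (t(c := f)) (v(c := r)) d \<longrightarrow>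
        good_run X k (2 * m + (card C - card (insert c D))) d q" for r
      using less.hyps[of m C "insert c D" "t(c := f)" "v(c := r)"] X C card
        witnesses_unrelated_query[OF un ask] by simp
    then obtain g where g: "\<And>r d. search_state X P C (insert c D) (t(c := f)) (v(c := r)) d \<Longrightarrow>
        good_run X k (2 * m + (card C - card (insert c D))) d (g r)"
      by metis
    have "good_run X k (2 * m + (card C - card D)) d (Query f c g)"
      if st: "search_state X P C D t v d" for d
    proof -
      have "good_run X k (Suc (2 * m + (card C - card (insert c D)))) d (Query f c g)"
        by (intro good_run_Query g search_state_query[OF st C(1) ask])
      moreover have "Suc (2 * m + (card C - card (insert c D))) = 2 * m + (card C - card D)"
        using card_D \<open>card (insert c D) \<le> card C\<close> by simp
      ultimately show ?thesis by simp
    qed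
    then show ?thesis by blast
  next
    case extend
    note wit = center_cost_le_witness[OF _ X C D extend(2)]
    show ?thesis
    proof (cases "D = {}")
      \<comment> \<open>No metric fits this state, so any tree will do.\<close>
      case True
      then have "\<not> search_state X P C D t v d" for d using wit by blast
      then show ?thesis by blast
    next
      case False
      obtain s where s: "s \<in> D" "\<forall>e\<in>D. v e \<le> v s" using ex_max_on_finite[OF finD False] by blast
      show ?thesis
      \<comment> \<open>The split must not depend on \<open>d\<close>. If the condition fails, every
        metric fitting the state has \<open>v s \<le> 0\<close>: a positive \<open>v s\<close> would
        put \<open>t s\<close> in \<open>C\<close>, at distance 0 from itself. The cost of
        \<open>C\<close> is then at most 0 and \<open>C\<close> can be output at once.\<close>
      proof (cases "v s > 0 \<and> t s \<notin> C \<and> t s \<in> X")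
        case True
        have card_C: "card (insert (t s) C) = Suc (card C)" using True finC by simp
        have card_D: "card (D - {s}) = card D - 1" "card D > 0"
          using s finD by (auto simp: card_gt_0_iff)
        have "witnesses_unrelated P (D - {s}) t" using un unfolding witnesses_unrelated_def by blast
        moreover have "insert (t s) C \<subseteq> X" "insert (t s) C \<noteq> {}" "D - {s} \<subseteq> insert (t s) C"
          "card (insert (t s) C) + (m - 1) = k"
          "3 * (m - 1) + (card (insert (t s) C) - card (D - {s})) < 3 * m + (card C - card D)"
          using C D True card card_C card_D extend(1) DC by auto
        ultimately obtain q where q: "\<forall>d. search_state X P (insert (t s) C) (D - {s}) t v d \<longrightarrow>
            good_run X k (2 * (m - 1) + (card (insert (t s) C) - card (D - {s}))) d q"
          using less.hyps[of "m - 1" "insert (t s) C" "D - {s}" t v] X by blast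
        have "2 * (m - 1) + (card (insert (t s) C) - card (D - {s})) = 2 * m + (card C - card D)"
          using card_C card_D extend(1) DC by simp
        then show ?thesis using q search_state_open[OF _ X C D un extend(2) s] by metis
      next
        case nonpos: False
        have "good_run X k (2 * m + (card C - card D)) d (Output C)"
          if st: "search_state X P C D t v d" for d
        proof (rule out)
          have m: "is_metric_on X d" and w: "t s \<in> X" "v s = d (t s) s"
            "\<And>c. c \<in> C \<Longrightarrow> d (t s) s \<le> d (t s) c"
            using st s unfolding search_state_def by auto
          have "v s \<le> 0"
          proof (rule ccontr)
            assume "\<not> v s \<le> 0"
            then have "t s \<in> C" using nonpos w by auto
            then have "v s \<le> d (t s) (t s)" using w by simp
            also have "\<dots> = 0" using m w unfolding is_metric_on_def by blast
            finally show False using \<open>\<not> v s \<le> 0\<close> by simp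
          qed
          obtain e where "e \<in> D" "center_cost X d C \<le> 2 * v e" using wit[OF st] by blast
          then have "center_cost X d C \<le> 0" using s \<open>v s \<le> 0\<close> by force
          moreover have "card C > 0" using finC C by (simp add: card_gt_0_iff)
          then have "0 \<le> opt_center X d k"
            using le_opt_centerI[of X k 0 d] X card center_cost_nonneg[OF X m] by simp
          ultimately show "center_cost X d C \<le> 4 * opt_center X d k" by simp
        qed
        then show ?thesis by blast
      qed
    qed
  qed
qed

lemma ex_query_algorithm:
  assumes "k > 0" "finite X" "X \<noteq> {}"
  shows "\<exists>q. \<forall>d. is_metric_on X d \<and> consistent_profile X d P \<longrightarrow> good_run X k (2 * k) d q"
proof -
  obtain x where x: "x \<in> X" using assms by auto
  have "witnesses_unrelated P {} t" for t :: "'a \<Rightarrow> 'a" unfolding witnesses_unrelated_def by simp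
  \<comment> \<open>The start is one arbitrary centre without witness; \<open>id\<close> and 0 are
    default values. Its budget is \<open>2 * (k - 1) + 1\<close>.\<close>
  then obtain q where q: "\<And>d. search_state X P {x} {} id (\<lambda>_. 0) d \<Longrightarrow>
      good_run X k (2 * (k - 1) + (card {x} - card ({} :: 'a set))) d q"
    using ex_search_tree[of X "{x}" "{}" "k - 1" k P id "\<lambda>_. 0"] assms x by auto
  have "good_run X k (2 * k) d q" if "is_metric_on X d" "consistent_profile X d P" for d
    by (rule good_run_mono[OF q]) (use that assms in \<open>auto simp: search_state_def\<close>)
  then show ?thesis by blast
qed

theorem mainTheorem3:
  fixes k :: nat
  assumes "k > 0"
  shows "\<exists>A :: 'a set \<Rightarrow> nat \<Rightarrow> ('a \<Rightarrow> 'a list) \<Rightarrow> 'a qtree.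
           \<forall>(X :: 'a set) d P.
             finite X \<and> X \<noteq> {} \<and> is_metric_on X d \<and> consistent_profile X d P \<longrightarrow>
             (let (C, q) = run_tree (A X k P) d in
                q \<le> 2 * k \<and> C \<subseteq> X \<and> C \<noteq> {} \<and> card C \<le> k \<and>
                center_cost X d C \<le> 4 * opt_center X d k)"
proof -
  \<comment> \<open>The tree is chosen before \<open>d\<close>, so the algorithm obtained by choice
    depends only on \<open>X\<close> and \<open>P\<close>; the premises on \<open>X\<close> stand
    under the existential to make it total.\<close>
  have "\<exists>q. finite X \<and> X \<noteq> {} \<longrightarrow>
      (\<forall>d. is_metric_on X d \<and> consistent_profile X d P \<longrightarrow> good_run X k (2 * k) d q)"
    for X :: "'a set" and P
    using ex_query_algorithm[OF assms] by blast
  then obtain A :: "'a set \<Rightarrow> ('a \<Rightarrow> 'a list) \<Rightarrow> 'a qtree" where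
    "\<And>X P d. finite X \<and> X \<noteq> {} \<and> is_metric_on X d \<and> consistent_profile X d P \<Longrightarrow>
       good_run X k (2 * k) d (A X P)"
    by metis
  then show ?thesis
    by (intro exI[of _ "\<lambda>X _. A X"]) (auto simp: good_run_def split_beta Let_def)
qed

end
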